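(* Let $m$ be a positive integer, let $t$ be an integer with $0\leq t\leq m$, and let $s_1,\dots,s_t$ be positive integers with $s_t\mid\cdots\mid s_1$. Let $A_m(\bm{s})$ be the $m\times\frac{m^2-m+2t}{2}$ integer matrix whose columns are $s_1\bm{e}_1,\dots,s_t\bm{e}_t$ together with $\bm{e}_i-\bm{e}_j$ for $1\leq i<j\leq m$, where $\bm{e}_i\in\mathbb{Z}^m$ is the $i$th standard unit column vector. Let $\rho:=s_1$ if $t\geq 1$ and $\rho:=1$ if $t=0$. Let $k$ be a positive integer with $k\mid\rho$, and for $1\leq i\leq t$ let $d_i:=\gcd(k,s_i)$. Then for every $q\in k+\rho\mathbb{Z}_{\geq 0}$, the number of $\bm{x}=(x_1,\dots,x_m)\in\mathbb{Z}_q^m$ such that every entry of $\bm{x}[A_m(\bm{s})]_q$ is nonzero (i.e. $s_ix_i\neq 0$ in $\mathbb{Z}_q$ for $1\leq i\leq t$ and $x_i-x_j\neq 0$ for $1\leq i<j\leq m$) equals $$\chi^k_{A_m(\bm{s})}(q)=\prod_{i=1}^{t}(q-d_i-i+1)\prod_{i=t+1}^{m}(q-i+1).$$ In other words, the $k$-constituent of the characteristic quasi-polynomial of $A_m(\bm{s})$ with respect to the period $\rho$ is the polynomial above.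
   Context: $\mathbb{Z}_q=\mathbb{Z}/q\mathbb{Z}$ and $[S]_q$ denotes entrywise reduction mod $q$ of an integer matrix $S$. For an integer matrix $S$ with $m$ rows and $n$ columns, the characteristic quasi-polynomial is $\chi_S^{quasi}(q)=\#\{\bm{x}\in\mathbb{Z}_q^m\mid \bm{x}[S]_q\in(\mathbb{Z}_q\setminus\{0\})^n\}$; it is a quasi-polynomial with period $\rho$ (here the lcm period), and its $k$-constituent $\chi^k_S$ is the polynomial agreeing with it on all $q\equiv k \pmod{\rho}$. Empty products equal $1$. *)

theory Defs
  imports
    "Jordan_Normal_Form.Matrix"
    "HOL-Computational_Algebra.Polynomial"
    "HOL-Number_Theory.Cong"
begin

(* The elements of Z_q (q > 0) are represented by their residues 0, ..., q - 1, so that an integer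
   a is zero in Z_q iff a mod q = 0. *)

definition Zq_vec :: "nat \<Rightarrow> nat \<Rightarrow> int vec set" where
  "Zq_vec q m = {x \<in> carrier_vec m. \<forall>i<m. x $ i \<in> {0..<int q}}"

definition reduce_mat :: "nat \<Rightarrow> int mat \<Rightarrow> int mat" where
  "reduce_mat q S = map_mat (\<lambda>a. a mod int q) S"

(* The row vector x times the matrix S over Z_q. *)
definition row_mult_mat :: "nat \<Rightarrow> int vec \<Rightarrow> int mat \<Rightarrow> int vec" where
  "row_mult_mat q x S = vec (dim_col S) (\<lambda>j. (x \<bullet> col S j) mod int q)"

definition char_quasi :: "int mat \<Rightarrow> nat \<Rightarrow> nat" where
  "char_quasi S q =
     card {x \<in> Zq_vec q (dim_row S).
             \<forall>j<dim_col S. row_mult_mat q x (reduce_mat q S) $ j \<noteq> 0}"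

(* q ranges over positive integers only: Z_q is finite just for q > 0. *)
definition is_constituent :: "int mat \<Rightarrow> nat \<Rightarrow> nat \<Rightarrow> int poly \<Rightarrow> bool" where
  "is_constituent S \<rho> k p \<longleftrightarrow>
     (\<forall>q>0. [q = k] (mod \<rho>) \<longrightarrow> int (char_quasi S q) = poly p (int q))"

(* For \<rho> > 0 at most one polynomial qualifies, since it is prescribed at infinitely many
   arguments. *)
definition constituent :: "int mat \<Rightarrow> nat \<Rightarrow> nat \<Rightarrow> int poly" where
  "constituent S \<rho> k = (THE p. is_constituent S \<rho> k p)"

(* Only s 1, ..., s t are used. Vector indices start at 0, hence the shift. *)
abbreviation e_vec :: "nat \<Rightarrow> nat \<Rightarrow> int vec" where
  "e_vec m i \<equiv> unit_vec m (i - 1)"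

definition A_mat :: "nat \<Rightarrow> nat \<Rightarrow> (nat \<Rightarrow> nat) \<Rightarrow> int mat" where
  "A_mat m t s = mat_of_cols m
     (map (\<lambda>i. int (s i) \<cdot>\<^sub>v e_vec m i) [1..<t + 1] @
      concat (map (\<lambda>i. map (\<lambda>j. e_vec m i - e_vec m j) [i + 1..<m + 1]) [1..<m + 1]))"

lemma dim_A_mat:
  "dim_row (A_mat m t s) = m"
  "dim_col (A_mat m t s) = (m\<^sup>2 - m + 2 * t) div 2"
proof -
  have "(\<Sum>i\<leftarrow>[1..<m + 1]. m - i) = (\<Sum>i = 1..m. m - i)"
    by (simp add: interv_sum_list_conv_sum_set_nat atLeastLessThanSuc_atLeastAtMost del: upt_Suc)
  also have "\<dots> = \<Sum>{..<m}"
    by (rule sum.reindex_bij_witness[of _ "\<lambda>i. m - i" "\<lambda>i. m - i"]) auto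
  finally have sum: "(\<Sum>i\<leftarrow>[1..<m + 1]. m - i) = \<Sum>{..<m}" .
  have "2 * \<Sum>{..<m} = m\<^sup>2 - m"
    by (induction m) (auto simp: power2_eq_square)
  moreover have "dim_col (A_mat m t s) = t + \<Sum>{..<m}"
    using sum by (simp add: A_mat_def length_concat o_def del: upt_Suc)
  ultimately show "dim_col (A_mat m t s) = (m\<^sup>2 - m + 2 * t) div 2"
    by simp
qed (simp add: A_mat_def)

end

theory Submission
  imports Defs
begin

text \<open>Choose $x_1, x_2, \dots$ in this order. The divisibility chain makes the sets of admissible
  values $U_i = \{x \mid s_i x \neq 0\}$ increasing in $i$, so the $i - 1$ values already chosen all
  lie in $U_i$, and exactly $|U_i| - (i - 1)$ choices remain for $x_i$. Finally,
  $|U_i| = q - \gcd(q, s_i)$, and $\gcd(q, s_i) = \gcd(k, s_i)$ because $s_i \mid \rho$.\<close>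

section \<open>Distinct choices from an increasing family of sets\<close>

lemma card_distinct_lists_increasing:
  fixes U :: "nat \<Rightarrow> 'a set"
  assumes "\<And>i. i < n \<Longrightarrow> finite (U i)"
    and "\<And>i j. i \<le> j \<Longrightarrow> j < n \<Longrightarrow> U i \<subseteq> U j"
  shows "finite {xs. length xs = n \<and> distinct xs \<and> (\<forall>i<n. xs ! i \<in> U i)} \<and>
    int (card {xs. length xs = n \<and> distinct xs \<and> (\<forall>i<n. xs ! i \<in> U i)}) =
      (\<Prod>i<n. int (card (U i)) - int i)"
  using assms
proof (induction n)
  case 0
  have "{xs. length xs = 0 \<and> distinct xs \<and> (\<forall>i<0. xs ! i \<in> U i)} = {[]}"
    by auto
  then show ?case
    by simp
next
  case (Suc n)
  define A where "A = {xs. length xs = n \<and> distinct xs \<and> (\<forall>i<n. xs ! i \<in> U i)}"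
  define B where "B = {xs. length xs = Suc n \<and> distinct xs \<and> (\<forall>i<Suc n. xs ! i \<in> U i)}"
  have IH: "finite A" "int (card A) = (\<Prod>i<n. int (card (U i)) - int i)"
    using Suc.IH Suc.prems unfolding A_def by (auto simp: less_Suc_eq)
  have fin: "finite (U n)"
    using Suc.prems by simp
  \<comment> \<open>The last entry is split off rather than the first: its set \<open>U n\<close> is
    the largest, so it contains every earlier entry.\<close>
  have B_eq: "B = (\<lambda>(xs, x). xs @ [x]) ` (SIGMA xs:A. U n - set xs)"
  proof (intro equalityI subsetI)
    fix ys assume ys: "ys \<in> B"
    then obtain xs x where "ys = xs @ [x]"
      by (cases ys rule: rev_cases) (auto simp: B_def)
    moreover from this have "xs \<in> A" "x \<in> U n - set xs"
      using ys by (auto simp: A_def B_def nth_append split: if_splits)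
    ultimately show "ys \<in> (\<lambda>(xs, x). xs @ [x]) ` (SIGMA xs:A. U n - set xs)"
      by force
  next
    fix ys assume "ys \<in> (\<lambda>(xs, x). xs @ [x]) ` (SIGMA xs:A. U n - set xs)"
    then show "ys \<in> B"
      by (auto simp: A_def B_def nth_append less_Suc_eq)
  qed
  have fibre: "int (card (U n - set xs)) = int (card (U n)) - int n" if "xs \<in> A" for xs
  proof -
    have "set xs \<subseteq> U n"
    proof
      fix x assume "x \<in> set xs"
      then obtain i where "i < length xs" "x = xs ! i"
        by (auto simp: in_set_conv_nth)
      then have "i < n" "x \<in> U i"
        using that by (auto simp: A_def)
      then show "x \<in> U n"
        using Suc.prems(2)[of i n] by auto
    qed
    moreover have "card (set xs) = n"
      using that by (simp add: A_def distinct_card)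
    ultimately show ?thesis
      using fin by (metis card_Diff_subset card_mono finite_subset of_nat_diff)
  qed
  have "inj_on (\<lambda>(xs, x). xs @ [x]) (SIGMA xs:A. U n - set xs)"
    by (auto simp: inj_on_def)
  then have "card B = (\<Sum>xs\<in>A. card (U n - set xs))"
    using IH(1) fin by (simp add: B_eq card_image card_SigmaI)
  \<comment> \<open>\<open>fibre\<close> is available only for lists in \<open>A\<close>, and this
    suffices: if \<open>U n\<close> has fewer than \<open>n\<close> elements, then \<open>A\<close>
    is empty and both sides vanish, so a negative integer factor does no harm.\<close>
  then have "int (card B) = int (card A) * (int (card (U n)) - int n)"
    by (simp add: fibre)
  moreover have "finite B"
    using IH(1) fin by (simp add: B_eq)
  ultimately show ?case
    using IH(2) by (simp add: B_def)
qed

section \<open>Residues annihilated by multiplication with s\<close>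

text \<open>Dividing \<open>q\<close> and \<open>s\<close> by their gcd \<open>g\<close> leaves
  coprime \<open>q'\<close> and \<open>s'\<close>. Hence the condition reduces to \<open>q'\<close>
  dividing \<open>x\<close>, and there are \<open>g\<close> multiples of \<open>q'\<close> in the
  range from 0 to below \<open>q = g * q'\<close>.\<close>

lemma card_residues_annihilated:
  fixes q s :: nat
  assumes "q > 0"
  shows "card {x \<in> {0..<int q}. int q dvd int s * x} = gcd q s"
proof -
  define g where "g = gcd q s"
  obtain q' s' where q': "q = g * q'" and s': "s = g * s'" and cop: "coprime q' s'"
    using gcd_coprime_exists[of q s] assms unfolding g_def by (metis gcd_eq_0_iff mult.commute not_gr0)
  have pos: "g > 0" "q' > 0"
    using assms q' by (auto intro: gr0I)
  have dvd_iff: "int q dvd int s * x \<longleftrightarrow> int q' dvd x" for x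
    using pos cop by (simp add: q' s' mult.assoc coprime_dvd_mult_right_iff)
  have "{x \<in> {0..<int q}. int q dvd int s * x} = (\<lambda>j. int q' * int j) ` {..<g}"
  proof (intro equalityI subsetI)
    fix x assume x: "x \<in> {x \<in> {0..<int q}. int q dvd int s * x}"
    then obtain y where y: "x = int q' * y"
      by (auto simp: dvd_iff elim: dvdE)
    have "0 \<le> y" "y < int g"
      using x pos by (auto simp: y q' zero_le_mult_iff mult.commute[of "int g"])
    then show "x \<in> (\<lambda>j. int q' * int j) ` {..<g}"
      by (intro image_eqI[of _ _ "nat y"]) (auto simp: y nat_less_iff)
  next
    fix x assume "x \<in> (\<lambda>j. int q' * int j) ` {..<g}"
    then obtain j where "x = int q' * int j" "j < g"
      by auto
    then show "x \<in> {x \<in> {0..<int q}. int q dvd int s * x}"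
      using pos unfolding mem_Collect_eq dvd_iff by (simp add: q' mult.commute[of g] flip: of_nat_mult)
  qed
  moreover have "inj_on (\<lambda>j. int q' * int j) {..<g}"
    using pos by (auto simp: inj_on_def)
  ultimately show ?thesis
    by (simp add: card_image g_def)
qed

section \<open>From the matrix to conditions on coordinates, and the count for one modulus\<close>

text \<open>Reducing the matrix entries before multiplying does not change the product modulo
  \<open>q\<close>. The count therefore depends only on integer dot products with the columns, and
  only on the set of columns.\<close>

lemma char_quasi_mat_of_cols:
  assumes "set cs \<subseteq> carrier_vec m"
  shows "char_quasi (mat_of_cols m cs) q =
    card {x \<in> Zq_vec q m. \<forall>c\<in>set cs. \<not> int q dvd x \<bullet> c}"
proof -
  have "row_mult_mat q x (reduce_mat q (mat_of_cols m cs)) $ j = (x \<bullet> (cs ! j)) mod int q"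
    if "x \<in> Zq_vec q m" "j < length cs" for x j
  proof -
    have c: "cs ! j \<in> carrier_vec m"
      using assms that by auto
    have "col (reduce_mat q (mat_of_cols m cs)) j = map_vec (\<lambda>a. a mod int q) (cs ! j)"
      using that c by (auto simp: reduce_mat_def mat_of_cols_index intro!: eq_vecI)
    moreover have "x \<bullet> map_vec (\<lambda>a. a mod int q) (cs ! j) mod int q = x \<bullet> (cs ! j) mod int q"
    proof -
      have "x \<bullet> map_vec (\<lambda>a. a mod int q) (cs ! j) mod int q =
          (\<Sum>i = 0..<m. x $ i * (cs ! j $ i mod int q)) mod int q"
        using c by (simp add: scalar_prod_def)
      \<comment> \<open>A reduction of each summand is inserted so that
        \<open>mod_mult_right_eq\<close> can then remove the one on the column entries.\<close>
      also have "\<dots> = (\<Sum>i = 0..<m. x $ i * (cs ! j $ i mod int q) mod int q) mod int q"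
        by (simp only: mod_sum_eq)
      also have "\<dots> = (\<Sum>i = 0..<m. x $ i * cs ! j $ i) mod int q"
        by (simp only: mod_mult_right_eq mod_sum_eq)
      finally show ?thesis
        using c by (simp add: scalar_prod_def)
    qed
    ultimately show ?thesis
      using that by (simp add: row_mult_mat_def reduce_mat_def)
  qed
  then have "{x \<in> Zq_vec q m. \<forall>j<length cs.
        row_mult_mat q x (reduce_mat q (mat_of_cols m cs)) $ j \<noteq> 0} =
      {x \<in> Zq_vec q m. \<forall>c\<in>set cs. \<not> int q dvd x \<bullet> c}"
    by (auto simp: all_set_conv_all_nth dvd_eq_mod_eq_0)
  then show ?thesis
    by (simp add: char_quasi_def)
qed

text \<open>The count for a single modulus, before any period is involved: the dependence on the
  \<open>s i\<close> is only through \<open>gcd q (s i)\<close>, which is constant on a residue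
  class modulo a common multiple of the \<open>s i\<close>.\<close>

lemma char_quasi_A_mat:
  assumes "t \<le> m" and "q > 0"
    and "\<And>i j. 1 \<le> i \<Longrightarrow> i \<le> j \<Longrightarrow> j \<le> t \<Longrightarrow> s j dvd s i"
  shows "int (char_quasi (A_mat m t s) q) =
    (\<Prod>i=1..t. int q - int (gcd q (s i)) - int i + 1) * (\<Prod>i=t+1..m. int q - int i + 1)"
proof -
  define cs where "cs = map (\<lambda>i. int (s i) \<cdot>\<^sub>v e_vec m i) [1..<t + 1] @
      concat (map (\<lambda>i. map (\<lambda>j. e_vec m i - e_vec m j) [i + 1..<m + 1]) [1..<m + 1])"
  \<comment> \<open>Admissible values of the coordinate with index \<open>i\<close>, counted from 0,
    hence \<open>s (i + 1)\<close>. For \<open>i\<close> at least \<open>t\<close> there is no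
    column \<open>s_i e_i\<close>, and all residues are admissible.\<close>
  define U where "U i = {x \<in> {0..<int q}. i < t \<longrightarrow> \<not> int q dvd int (s (i + 1)) * x}" for i
  define L where "L = {xs. length xs = m \<and> distinct xs \<and> (\<forall>i<m. xs ! i \<in> U i)}"
  define V where "V = {x \<in> Zq_vec q m. \<forall>c\<in>set cs. \<not> int q dvd x \<bullet> c}"
  have cs_set: "set cs = (\<lambda>i. int (s i) \<cdot>\<^sub>v e_vec m i) ` {1..<t + 1} \<union>
      (\<Union>i\<in>{1..<m + 1}. (\<lambda>j. e_vec m i - e_vec m j) ` {i + 1..<m + 1})"
    by (simp add: cs_def del: upt_Suc)
  have "A_mat m t s = mat_of_cols m cs"
    by (simp add: A_mat_def cs_def)
  moreover have "set cs \<subseteq> carrier_vec m"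
    unfolding cs_set by auto
  ultimately have quasi: "char_quasi (A_mat m t s) q = card V"
    by (simp add: char_quasi_mat_of_cols V_def)
  \<comment> \<open>The columns \<open>s_i e_i\<close> become membership in \<open>U i\<close>, the
    difference columns become distinctness of the coordinates. The range condition of
    \<open>Zq_vec\<close> is already part of \<open>U i\<close>.\<close>
  have V_iff: "x \<in> V \<longleftrightarrow> (\<forall>i<m. x $ i \<in> U i) \<and> (\<forall>i j. i < j \<longrightarrow> j < m \<longrightarrow> x $ i \<noteq> x $ j)"
    if x: "x \<in> carrier_vec m" for x
  proof -
    have unit: "x \<bullet> (int (s i) \<cdot>\<^sub>v e_vec m i) = int (s i) * x $ (i - 1)"
      if "i \<in> {1..<t + 1}" for i
      using that x assms(1) by auto
    have diff: "x \<bullet> (e_vec m i - e_vec m j) = x $ (i - 1) - x $ (j - 1)"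
      if "i \<in> {1..<m + 1}" "j \<in> {i + 1..<m + 1}" for i j
    proof -
      have "i - 1 < m" "j - 1 < m"
        using that by auto
      then show ?thesis
        using x by (simp add: scalar_prod_minus_distrib[of _ m])
    qed
    \<comment> \<open>Columns are numbered from 1 and coordinates from 0;
      \<open>i - 1 + 1 = i\<close> is valid because the column index is at least 1. The same shift
      occurs in \<open>diffs\<close>.\<close>
    have units: "(\<forall>i\<in>{1..<t + 1}. \<not> int q dvd x \<bullet> (int (s i) \<cdot>\<^sub>v e_vec m i)) \<longleftrightarrow>
        (\<forall>i<t. \<not> int q dvd int (s (i + 1)) * x $ i)" (is "?l \<longleftrightarrow> ?r")
    proof
      assume ?l
      show ?r
      proof (intro allI impI)
        fix i assume "i < t"
        then show "\<not> int q dvd int (s (i + 1)) * x $ i"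
          using \<open>?l\<close>[rule_format, of "i + 1"] unit[of "i + 1"] by simp
      qed
    next
      assume ?r
      show ?l
      proof
        fix i assume i: "i \<in> {1..<t + 1}"
        then have "i - 1 < t" "i - 1 + 1 = i"
          by auto
        then show "\<not> int q dvd x \<bullet> (int (s i) \<cdot>\<^sub>v e_vec m i)"
          using \<open>?r\<close> unit[OF i] by metis
      qed
    qed
    have diffs: "(\<forall>i\<in>{1..<m + 1}. \<forall>j\<in>{i + 1..<m + 1}. \<not> int q dvd x \<bullet> (e_vec m i - e_vec m j)) \<longleftrightarrow>
        (\<forall>i j. i < j \<longrightarrow> j < m \<longrightarrow> \<not> int q dvd x $ i - x $ j)" (is "?l \<longleftrightarrow> ?r")
    proof
      assume ?l
      show ?r
      proof (intro allI impI)
        fix i j assume "i < j" "j < m"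
        then show "\<not> int q dvd x $ i - x $ j"
          using \<open>?l\<close>[rule_format, of "i + 1" "j + 1"] diff[of "i + 1" "j + 1"] by simp
      qed
    next
      assume ?r
      show ?l
      proof (intro ballI)
        fix i j assume ij: "i \<in> {1..<m + 1}" "j \<in> {i + 1..<m + 1}"
        then have "i - 1 < j - 1" "j - 1 < m"
          by auto
        then show "\<not> int q dvd x \<bullet> (e_vec m i - e_vec m j)"
          using \<open>?r\<close> diff[OF ij] by metis
      qed
    qed
    \<comment> \<open>Two representatives in the range from 0 to below \<open>q\<close> are
      congruent modulo \<open>q\<close> only if they are equal.\<close>
    have dvd_diff: "int q dvd x $ i - x $ j \<longleftrightarrow> x $ i = x $ j"
      if "x $ i \<in> {0..<int q}" "x $ j \<in> {0..<int q}" for i j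
      using that by (auto simp: mod_eq_dvd_iff[symmetric])
    have "x \<in> V \<longleftrightarrow> x \<in> Zq_vec q m \<and> (\<forall>i<t. \<not> int q dvd int (s (i + 1)) * x $ i) \<and>
        (\<forall>i j. i < j \<longrightarrow> j < m \<longrightarrow> \<not> int q dvd x $ i - x $ j)"
      unfolding units[symmetric] diffs[symmetric] V_def cs_set by blast
    also have "\<dots> \<longleftrightarrow> x \<in> Zq_vec q m \<and> (\<forall>i<t. \<not> int q dvd int (s (i + 1)) * x $ i) \<and>
        (\<forall>i j. i < j \<longrightarrow> j < m \<longrightarrow> x $ i \<noteq> x $ j)"
    proof (rule conj_cong[OF refl])
      assume "x \<in> Zq_vec q m"
      then have "x $ i \<in> {0..<int q}" if "i < m" for i
        using that by (simp add: Zq_vec_def)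
      then have "(\<forall>i j. i < j \<longrightarrow> j < m \<longrightarrow> \<not> int q dvd x $ i - x $ j) \<longleftrightarrow>
          (\<forall>i j. i < j \<longrightarrow> j < m \<longrightarrow> x $ i \<noteq> x $ j)"
        using dvd_diff by (metis order.strict_trans)
      then show "(\<forall>i<t. \<not> int q dvd int (s (i + 1)) * x $ i) \<and>
          (\<forall>i j. i < j \<longrightarrow> j < m \<longrightarrow> \<not> int q dvd x $ i - x $ j) \<longleftrightarrow>
          (\<forall>i<t. \<not> int q dvd int (s (i + 1)) * x $ i) \<and>
          (\<forall>i j. i < j \<longrightarrow> j < m \<longrightarrow> x $ i \<noteq> x $ j)"
        by simp
    qed
    \<comment> \<open>Since t \<le> m, the conditions for \<open>i < t\<close> are all among those
      for \<open>i < m\<close>.\<close>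
    also have "\<dots> \<longleftrightarrow> (\<forall>i<m. x $ i \<in> U i) \<and> (\<forall>i j. i < j \<longrightarrow> j < m \<longrightarrow> x $ i \<noteq> x $ j)"
      using x assms(1) by (auto simp: Zq_vec_def U_def)
    finally show ?thesis .
  qed
  \<comment> \<open>Vectors are turned into lists so that the count of distinct lists
    applies.\<close>
  have "bij_betw list_of_vec V L"
  proof (rule bij_betw_byWitness[where f' = vec_of_list])
    show "list_of_vec ` V \<subseteq> L"
    proof safe
      fix x assume x: "x \<in> V"
      then have "x \<in> carrier_vec m"
        by (simp add: V_def Zq_vec_def)
      moreover from this have "distinct (list_of_vec x)"
        using x V_iff by (auto simp: distinct_conv_nth list_of_vec_index) (metis nat_neq_iff)
      ultimately show "list_of_vec x \<in> L"
        using x V_iff by (auto simp: L_def list_of_vec_index)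
    qed
    show "vec_of_list ` L \<subseteq> V"
    proof safe
      fix xs assume xs: "xs \<in> L"
      then have "vec_of_list xs \<in> carrier_vec m"
        by (simp add: L_def carrier_vecI)
      from V_iff[OF this] show "vec_of_list xs \<in> V"
        using xs by (auto simp: L_def vec_of_list_index nth_eq_iff_index_eq)
    qed
  qed (auto simp: vec_list list_vec)
  then have "int (card V) = int (card L)"
    by (simp add: bij_betw_same_card)
  also have "\<dots> = (\<Prod>i<m. int (card (U i)) - int i)"
  proof -
    \<comment> \<open>The divisibility chain enters here: \<open>s (j + 1)\<close> divides
      \<open>s (i + 1)\<close>, so a residue annihilated by the former is annihilated by the latter.
      For \<open>j\<close> at least \<open>t\<close> the set \<open>U j\<close> contains all
      residues.\<close>
    have "U i \<subseteq> U j" if "i \<le> j" for i j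
    proof
      fix x assume x: "x \<in> U i"
      have "\<not> int q dvd int (s (j + 1)) * x" if "j < t"
      proof
        assume "int q dvd int (s (j + 1)) * x"
        moreover have "int (s (j + 1)) * x dvd int (s (i + 1)) * x"
          using assms(3)[of "i + 1" "j + 1"] \<open>i \<le> j\<close> that by (simp add: mult_dvd_mono)
        ultimately show False
          using x \<open>i \<le> j\<close> that by (auto simp: U_def intro: dvd_trans)
      qed
      then show "x \<in> U j"
        using x by (auto simp: U_def)
    qed
    moreover have "finite (U i)" for i
      by (rule finite_subset[of _ "{0..<int q}"]) (auto simp: U_def)
    ultimately show ?thesis
      using card_distinct_lists_increasing[of m U] by (simp add: L_def)
  qed
  also have "\<dots> = (\<Prod>i\<in>{1..m}. int (card (U (i - 1))) - int (i - 1))"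
    by (rule prod.reindex_bij_witness[of _ "\<lambda>i. i - 1" Suc]) auto
  also have "\<dots> = (\<Prod>i\<in>{1..t} \<union> {t+1..m}. int (card (U (i - 1))) - int (i - 1))"
    using assms(1) by (intro prod.cong) auto
  also have "\<dots> = (\<Prod>i=1..t. int (card (U (i - 1))) - int (i - 1)) *
      (\<Prod>i=t+1..m. int (card (U (i - 1))) - int (i - 1))"
    by (rule prod.union_disjoint) auto
  \<comment> \<open>In the first \<open>t\<close> factors, \<open>U (i - 1)\<close> is the
    complement of the residues annihilated by \<open>s i\<close>.\<close>
  also have "(\<Prod>i=1..t. int (card (U (i - 1))) - int (i - 1)) =
      (\<Prod>i=1..t. int q - int (gcd q (s i)) - int i + 1)"
  proof (rule prod.cong)
    fix i assume i: "i \<in> {1..t}"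
    then have "U (i - 1) = {0..<int q} - {x \<in> {0..<int q}. int q dvd int (s i) * x}"
      by (auto simp: U_def)
    moreover have "card ({0..<int q} - {x \<in> {0..<int q}. int q dvd int (s i) * x}) =
        card {0..<int q} - card {x \<in> {0..<int q}. int q dvd int (s i) * x}"
    proof (rule card_Diff_subset)
      show "finite {x \<in> {0..<int q}. int q dvd int (s i) * x}"
        by (rule finite_subset[of _ "{0..<int q}"]) auto
    qed auto
    ultimately have "card (U (i - 1)) = q - gcd q (s i)"
      using card_residues_annihilated[OF assms(2)] by simp
    \<comment> \<open>No truncation occurs: the gcd is at most \<open>q\<close> because
      \<open>q > 0\<close>, and \<open>i\<close> is at least 1. The shift \<open>i - 1\<close>
      produces the final \<open>+ 1\<close>.\<close>
    then show "int (card (U (i - 1))) - int (i - 1) = int q - int (gcd q (s i)) - int i + 1"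
      using i assms(2) by (simp add: of_nat_diff)
  qed simp
  also have "(\<Prod>i=t+1..m. int (card (U (i - 1))) - int (i - 1)) = (\<Prod>i=t+1..m. int q - int i + 1)"
  proof (rule prod.cong)
    fix i assume i: "i \<in> {t+1..m}"
    then have "U (i - 1) = {0..<int q}"
      by (auto simp: U_def)
    then show "int (card (U (i - 1))) - int (i - 1) = int q - int i + 1"
      using i by (simp add: of_nat_diff)
  qed simp
  finally show ?thesis
    by (simp add: quasi)
qed

section \<open>Uniqueness and computation of the constituent\<close>

text \<open>Two candidates agree on an infinite arithmetic progression, so their difference has
  infinitely many roots and is zero. This lets \<open>THE\<close> be evaluated.\<close>

lemma constituent_eqI:
  assumes "is_constituent S \<rho> k p" and "\<rho> > 0"
  shows "constituent S \<rho> k = p"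
  unfolding constituent_def
proof (rule the_equality)
  fix p' assume p': "is_constituent S \<rho> k p'"
  \<comment> \<open>\<open>Suc n\<close> keeps every argument positive even for
    \<open>k = 0\<close>, as \<open>is_constituent\<close> speaks about positive \<open>q\<close>
    only.\<close>
  have "(\<lambda>n. int (k + \<rho> * Suc n)) ` UNIV \<subseteq> {x. poly (p' - p) x = 0}"
  proof safe
    fix n
    have "[k + \<rho> * Suc n = k] (mod \<rho>)"
      by (simp add: cong_def del: mult_Suc_right)
    then show "poly (p' - p) (int (k + \<rho> * Suc n)) = 0"
      using assms p' unfolding is_constituent_def
      by (metis add_gr_0 eq_iff_diff_eq_0 mult_pos_pos poly_diff zero_less_Suc)
  qed
  moreover have "infinite ((\<lambda>n. int (k + \<rho> * Suc n)) ` UNIV)"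
    using assms(2) by (intro range_inj_infinite) (auto simp: inj_def)
  ultimately have "p' - p = 0"
    using poly_roots_finite finite_subset by blast
  then show "p' = p"
    by simp
qed (fact assms(1))

theorem theorem3p2:
  fixes m t k \<rho> :: nat and s :: "nat \<Rightarrow> nat"
  assumes "m > 0" and "t \<le> m"
    and "\<forall>i\<in>{1..t}. s i > 0"
    and "\<forall>i. 1 \<le> i \<and> i < t \<longrightarrow> s (i + 1) dvd s i"
    and "\<rho> = (if t \<ge> 1 then s 1 else 1)"
    and "k > 0" and "k dvd \<rho>"
  shows "(\<forall>q \<in> {k + \<rho> * n | n. True}.
            int (char_quasi (A_mat m t s) q) = poly (constituent (A_mat m t s) \<rho> k) (int q) \<and>
            poly (constituent (A_mat m t s) \<rho> k) (int q) =
              (\<Prod>i=1..t. int q - int (gcd k (s i)) - int i + 1) *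
              (\<Prod>i=t+1..m. int q - int i + 1)) \<and>
         is_constituent (A_mat m t s) \<rho> k (constituent (A_mat m t s) \<rho> k) \<and>
         constituent (A_mat m t s) \<rho> k =
           (\<Prod>i=1..t. [:- int (gcd k (s i)) - int i + 1, 1:]) *
           (\<Prod>i=t+1..m. [:- int i + 1, 1:])"
proof -
  define P where "P = (\<Prod>i=1..t. [:- int (gcd k (s i)) - int i + 1, 1:]) *
    (\<Prod>i=t+1..m. [:- int i + 1, 1:])"
  \<comment> \<open>Divisibility of neighbours extends to all pairs by induction on \<open>j\<close>
    starting from \<open>i\<close>; the bound on \<open>j\<close> is carried along.\<close>
  have chain: "s j dvd s i" if "1 \<le> i" "i \<le> j" "j \<le> t" for i j
    using that(2,3)
  proof (induction j rule: dec_induct)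
    case (step n)
    then show ?case
      using assms(4) that(1) by (auto intro: dvd_trans)
  qed simp
  have poly_P: "poly P (int q) = (\<Prod>i=1..t. int q - int (gcd k (s i)) - int i + 1) *
      (\<Prod>i=t+1..m. int q - int i + 1)" for q
    by (simp add: P_def poly_prod algebra_simps)
  have P: "is_constituent (A_mat m t s) \<rho> k P"
    unfolding is_constituent_def
  proof (intro allI impI)
    fix q assume q: "q > 0" "[q = k] (mod \<rho>)"
    \<comment> \<open>Each \<open>s i\<close> divides \<open>s 1\<close>, which is the period since
      \<open>t\<close> is at least 1 here. So \<open>q\<close> and \<open>k\<close> are congruent
      modulo \<open>s i\<close> and have the same gcd with it.\<close>
    have "gcd q (s i) = gcd k (s i)" if "i \<in> {1..t}" for i
    proof -
      have "s i dvd \<rho>"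
        using that chain[of 1 i] assms(5) by auto
      then have "[q = k] (mod s i)"
        using q(2) cong_dvd_modulus_nat by blast
      then show ?thesis
        by (rule cong_gcd_eq)
    qed
    then show "int (char_quasi (A_mat m t s) q) = poly P (int q)"
      using char_quasi_A_mat[OF assms(2) q(1) chain] by (simp add: poly_P)
  qed
  have "\<rho> > 0"
    using assms(3,5) by auto
  then have eq: "constituent (A_mat m t s) \<rho> k = P"
    using P constituent_eqI by blast
  \<comment> \<open>Here \<open>k > 0\<close> guarantees that every \<open>q\<close> in the
    progression, including \<open>q = k\<close>, is positive.\<close>
  have "int (char_quasi (A_mat m t s) q) = poly P (int q)" if "q \<in> {k + \<rho> * n | n. True}" for q
    using that P assms(6) by (auto simp: is_constituent_def cong_def)
  then show ?thesis
    unfolding eq using P poly_P by (simp add: P_def)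
qed

end
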